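(* Let $(B,C)$ be a contact algebra, regarded as a trivial dynamic contact algebra $A=(B,C^s,C^t,\mathcal{B})$ with $C^s=C$ and $aC^tb$ iff $a\mathcal{B}b$ iff ($a\neq0$ and $b\neq0$). Then (i) the algebra $RC(A_+)$ is a trivial DCA, and (ii) the map $g_A$ is a stable isomorphic embedding of $A$ into $RC(A_+)$.
   Context: Contact relation on a Boolean algebra: $aCb\Rightarrow a,b\neq0$; upward monotone; $aC(b+c)\Rightarrow aCb\vee aCc$; $(a+b)Cc\Rightarrow aCc\vee bCc$; symmetric; $a\cdot b\neq0\Rightarrow aCb$. A trivial DCA is a dynamic contact algebra in which $a\neq0$ and $b\neq0$ imply $aC^tb$ and $a\mathcal{B}b$. t-clans (s-clans) of $A$: $\Gamma\subseteq B$ with $1\in\Gamma$, $0\notin\Gamma$, upward closed, $a+b\in\Gamma\Rightarrow a\in\Gamma\vee b\in\Gamma$, pairwise $C^t$- (resp. $C^s$-) related; clusters: t-clans with $\forall a\notin\Gamma\exists b\in\Gamma\,a\overline{C^t}b$. Canonical space $A_+$: $X^t_A$ = t-clans, $X^s_A$ = s-clans, $T_A$ = clusters, $\Gamma\prec_A\Delta$ iff $a\mathcal{B}b$ for all $a\in\Gamma,b\in\Delta$, $g_A(a)=\{\Gamma\in X^t_A:a\in\Gamma\}$, topology on $X^t_A$ with closed base $\{g_A(a):a\in B\}$. $RC(A_+)$ is the Boolean algebra of regular closed subsets of $X^t_A$ with $aC^tb$ iff $a\cap b\neq\emptyset$, $aC^sb$ iff $a\cap b\cap X^s_A\neq\emptyset$,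 $a\mathcal{B}b$ iff $\exists x\in a,y\in b\,x\prec_Ay$. A stable isomorphic embedding is an injective Boolean homomorphism preserving and reflecting $C^s,C^t,\mathcal{B}$ whose image $A_1$ in $A_2=RC(A_+)$ satisfies: every nonzero $a_2$ has a nonzero $a_1\le a_2$ in $A_1$, and for each $C\in\{C^s,C^t,\mathcal{B}\}$, $a_2\overline{C}b_2$ implies $\exists a_1,b_1\in A_1$ with $a_1\overline{C}b_1$, $a_2\le a_1$, $b_2\le b_1$. *)

theory Defs
  imports "HOL-Algebra.Lattice" "HOL-Analysis.Abstract_Topology"
begin

section \<open>Boolean algebras and contact relations\<close>

locale boolean_lattice = bounded_lattice L for L (structure) +
  assumes distrib: "\<lbrakk>x \<in> carrier L; y \<in> carrier L; z \<in> carrier L\<rbrakk>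
      \<Longrightarrow> x \<sqinter> (y \<squnion> z) = (x \<sqinter> y) \<squnion> (x \<sqinter> z)"
    and complemented: "x \<in> carrier L
      \<Longrightarrow> \<exists>y \<in> carrier L. x \<squnion> y = \<top> \<and> x \<sqinter> y = \<bottom>"

definition compl :: "('a, 'm) gorder_scheme \<Rightarrow> 'a \<Rightarrow> 'a" where
  "compl L x = (THE y. y \<in> carrier L \<and> x \<squnion>\<^bsub>L\<^esub> y = \<top>\<^bsub>L\<^esub> \<and> x \<sqinter>\<^bsub>L\<^esub> y = \<bottom>\<^bsub>L\<^esub>)"

definition precontact :: "('a, 'm) gorder_scheme \<Rightarrow> ('a \<Rightarrow> 'a \<Rightarrow> bool) \<Rightarrow> bool" where
  "precontact L C \<longleftrightarrow>
     (\<forall>a\<in>carrier L. \<forall>b\<in>carrier L. C a b \<longrightarrow> a \<noteq> \<bottom>\<^bsub>L\<^esub> \<and> b \<noteq> \<bottom>\<^bsub>L\<^esub>) \<and>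
     (\<forall>a\<in>carrier L. \<forall>b\<in>carrier L. \<forall>a'\<in>carrier L. \<forall>b'\<in>carrier L.
        C a b \<and> a \<sqsubseteq>\<^bsub>L\<^esub> a' \<and> b \<sqsubseteq>\<^bsub>L\<^esub> b' \<longrightarrow> C a' b') \<and>
     (\<forall>a\<in>carrier L. \<forall>b\<in>carrier L. \<forall>c\<in>carrier L. C a (b \<squnion>\<^bsub>L\<^esub> c) \<longrightarrow> C a b \<or> C a c) \<and>
     (\<forall>a\<in>carrier L. \<forall>b\<in>carrier L. \<forall>c\<in>carrier L. C (a \<squnion>\<^bsub>L\<^esub> b) c \<longrightarrow> C a c \<or> C b c)"

definition contact :: "('a, 'm) gorder_scheme \<Rightarrow> ('a \<Rightarrow> 'a \<Rightarrow> bool) \<Rightarrow> bool" where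
  "contact L C \<longleftrightarrow> precontact L C \<and>
     (\<forall>a\<in>carrier L. \<forall>b\<in>carrier L. C a b \<longrightarrow> C b a) \<and>
     (\<forall>a\<in>carrier L. \<forall>b\<in>carrier L. a \<sqinter>\<^bsub>L\<^esub> b \<noteq> \<bottom>\<^bsub>L\<^esub> \<longrightarrow> C a b)"

definition contact_algebra :: "('a, 'm) gorder_scheme \<Rightarrow> ('a \<Rightarrow> 'a \<Rightarrow> bool) \<Rightarrow> bool" where
  "contact_algebra L C \<longleftrightarrow> boolean_lattice L \<and> contact L C"


section \<open>Dynamic contact algebras\<close>

text \<open>Space contact \<open>Cs\<close>, time contact \<open>Ct\<close> and precedence \<open>Bf\<close> on top of a Boolean
  lattice.  Only the values of the relations on the carrier matter.\<close>

record 'a dyn_struct = "'a gorder" +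
  Cs :: "'a \<Rightarrow> 'a \<Rightarrow> bool"
  Ct :: "'a \<Rightarrow> 'a \<Rightarrow> bool"
  Bf :: "'a \<Rightarrow> 'a \<Rightarrow> bool"

text \<open>Vakarelov's axioms: besides the (pre)contact axioms, space contact implies time contact,
  \<open>Ct\<close> satisfies the Efremovich axiom, and \<open>Bf\<close> interpolates with \<open>Ct\<close> on both sides.\<close>

definition dca :: "'a dyn_struct \<Rightarrow> bool" where
  "dca A \<longleftrightarrow> boolean_lattice A \<and>
     contact A (Cs A) \<and> contact A (Ct A) \<and> precontact A (Bf A) \<and>
     (\<forall>a\<in>carrier A. \<forall>b\<in>carrier A. Cs A a b \<longrightarrow> Ct A a b) \<and>
     (\<forall>a\<in>carrier A. \<forall>b\<in>carrier A. \<not> Ct A a b \<longrightarrow>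
        (\<exists>c\<in>carrier A. \<not> Ct A a c \<and> \<not> Ct A (compl A c) b)) \<and>
     (\<forall>a\<in>carrier A. \<forall>b\<in>carrier A. \<not> Bf A a b \<longrightarrow>
        (\<exists>c\<in>carrier A. \<not> Ct A a c \<and> \<not> Bf A (compl A c) b)) \<and>
     (\<forall>a\<in>carrier A. \<forall>b\<in>carrier A. \<not> Bf A a b \<longrightarrow>
        (\<exists>c\<in>carrier A. \<not> Bf A a c \<and> \<not> Ct A (compl A c) b))"

definition trivial_dca :: "'a dyn_struct \<Rightarrow> bool" where
  "trivial_dca A \<longleftrightarrow> dca A \<and>
     (\<forall>a\<in>carrier A. \<forall>b\<in>carrier A. a \<noteq> \<bottom>\<^bsub>A\<^esub> \<and> b \<noteq> \<bottom>\<^bsub>A\<^esub> \<longrightarrow> Ct A a b \<and> Bf A a b)"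

definition trivial_dca_of :: "'a gorder \<Rightarrow> ('a \<Rightarrow> 'a \<Rightarrow> bool) \<Rightarrow> 'a dyn_struct" where
  "trivial_dca_of L C = gorder.extend L
     (dyn_struct.fields C
       (\<lambda>a b. a \<noteq> \<bottom>\<^bsub>L\<^esub> \<and> b \<noteq> \<bottom>\<^bsub>L\<^esub>)
       (\<lambda>a b. a \<noteq> \<bottom>\<^bsub>L\<^esub> \<and> b \<noteq> \<bottom>\<^bsub>L\<^esub>))"


section \<open>Clans, clusters and the canonical space\<close>

definition clan :: "('a, 'm) gorder_scheme \<Rightarrow> ('a \<Rightarrow> 'a \<Rightarrow> bool) \<Rightarrow> 'a set \<Rightarrow> bool" where
  "clan L C \<Gamma> \<longleftrightarrow> \<Gamma> \<subseteq> carrier L \<and> \<top>\<^bsub>L\<^esub> \<in> \<Gamma> \<and> \<bottom>\<^bsub>L\<^esub> \<notin> \<Gamma> \<and>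
     (\<forall>a\<in>\<Gamma>. \<forall>b\<in>carrier L. a \<sqsubseteq>\<^bsub>L\<^esub> b \<longrightarrow> b \<in> \<Gamma>) \<and>
     (\<forall>a\<in>carrier L. \<forall>b\<in>carrier L. a \<squnion>\<^bsub>L\<^esub> b \<in> \<Gamma> \<longrightarrow> a \<in> \<Gamma> \<or> b \<in> \<Gamma>) \<and>
     (\<forall>a\<in>\<Gamma>. \<forall>b\<in>\<Gamma>. C a b)"

definition t_clans :: "'a dyn_struct \<Rightarrow> 'a set set" where
  "t_clans A = {\<Gamma>. clan A (Ct A) \<Gamma>}"

definition s_clans :: "'a dyn_struct \<Rightarrow> 'a set set" where
  "s_clans A = {\<Gamma>. clan A (Cs A) \<Gamma>}"

definition t_clusters :: "'a dyn_struct \<Rightarrow> 'a set set" where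
  "t_clusters A = {\<Gamma> \<in> t_clans A. \<forall>a \<in> carrier A - \<Gamma>. \<exists>b\<in>\<Gamma>. \<not> Ct A a b}"

definition g :: "'a dyn_struct \<Rightarrow> 'a \<Rightarrow> 'a set set" where
  "g A a = {\<Gamma> \<in> t_clans A. a \<in> \<Gamma>}"

text \<open>The sets \<open>g A a\<close> form a closed base, that is, their complements form an open base.
  The constructor \<open>topology\<close> is only meaningful for a genuine base; see
  \<open>openin_clan_topology\<close> below.\<close>

definition clan_topology :: "'a dyn_struct \<Rightarrow> 'a set topology" where
  "clan_topology A =
     topology (arbitrary union_of (\<lambda>U. \<exists>a\<in>carrier A. U = t_clans A - g A a))"

record 'p dyn_space =
  time_space :: "'p topology"
  space_pts :: "'p set"
  time_pts :: "'p set"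
  before :: "'p \<Rightarrow> 'p \<Rightarrow> bool"

definition canonical_space :: "'a dyn_struct \<Rightarrow> 'a set dyn_space" where
  "canonical_space A =
     \<lparr>time_space = clan_topology A,
      space_pts = s_clans A,
      time_pts = t_clusters A,
      before = (\<lambda>\<Gamma> \<Delta>. \<forall>a\<in>\<Gamma>. \<forall>b\<in>\<Delta>. Bf A a b)\<rparr>"

text \<open>Regular closed sets ordered by inclusion: the Boolean operations of \<open>RC\<close> are those
  determined by this order (join is union, meet is the closure of the interior of the
  intersection, complement is the closure of the set complement).\<close>

definition RC :: "'p dyn_space \<Rightarrow> 'p set dyn_struct" where
  "RC S =
     \<lparr>carrier = {a. a \<subseteq> topspace (time_space S) \<and>
        time_space S closure_of (time_space S interior_of a) = a},
      eq = (=),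
      le = (\<subseteq>),
      Cs = (\<lambda>a b. a \<inter> b \<inter> space_pts S \<noteq> {}),
      Ct = (\<lambda>a b. a \<inter> b \<noteq> {}),
      Bf = (\<lambda>a b. \<exists>x\<in>a. \<exists>y\<in>b. before S x y)\<rparr>"


section \<open>Stable isomorphic embeddings\<close>

definition boolean_hom ::
  "('a, 'm) gorder_scheme \<Rightarrow> ('b, 'n) gorder_scheme \<Rightarrow> ('a \<Rightarrow> 'b) \<Rightarrow> bool" where
  "boolean_hom L M f \<longleftrightarrow> f \<in> carrier L \<rightarrow> carrier M \<and>
     (\<forall>a\<in>carrier L. \<forall>b\<in>carrier L. f (a \<squnion>\<^bsub>L\<^esub> b) = f a \<squnion>\<^bsub>M\<^esub> f b) \<and>
     (\<forall>a\<in>carrier L. \<forall>b\<in>carrier L. f (a \<sqinter>\<^bsub>L\<^esub> b) = f a \<sqinter>\<^bsub>M\<^esub> f b) \<and>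
     (\<forall>a\<in>carrier L. f (compl L a) = compl M (f a)) \<and>
     f \<bottom>\<^bsub>L\<^esub> = \<bottom>\<^bsub>M\<^esub> \<and> f \<top>\<^bsub>L\<^esub> = \<top>\<^bsub>M\<^esub>"

definition dense_in :: "('a, 'm) gorder_scheme \<Rightarrow> 'a set \<Rightarrow> bool" where
  "dense_in M A1 \<longleftrightarrow> (\<forall>a2\<in>carrier M. a2 \<noteq> \<bottom>\<^bsub>M\<^esub> \<longrightarrow>
     (\<exists>a1\<in>A1. a1 \<noteq> \<bottom>\<^bsub>M\<^esub> \<and> a1 \<sqsubseteq>\<^bsub>M\<^esub> a2))"

definition separable_in ::
  "('a, 'm) gorder_scheme \<Rightarrow> ('a \<Rightarrow> 'a \<Rightarrow> bool) \<Rightarrow> 'a set \<Rightarrow> bool" where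
  "separable_in M C A1 \<longleftrightarrow> (\<forall>a2\<in>carrier M. \<forall>b2\<in>carrier M. \<not> C a2 b2 \<longrightarrow>
     (\<exists>a1\<in>A1. \<exists>b1\<in>A1. \<not> C a1 b1 \<and> a2 \<sqsubseteq>\<^bsub>M\<^esub> a1 \<and> b2 \<sqsubseteq>\<^bsub>M\<^esub> b1))"

definition stable_embedding ::
  "'a dyn_struct \<Rightarrow> 'b dyn_struct \<Rightarrow> ('a \<Rightarrow> 'b) \<Rightarrow> bool" where
  "stable_embedding A M f \<longleftrightarrow> boolean_hom A M f \<and> inj_on f (carrier A) \<and>
     (\<forall>a\<in>carrier A. \<forall>b\<in>carrier A.
        (Cs A a b \<longleftrightarrow> Cs M (f a) (f b)) \<and>
        (Ct A a b \<longleftrightarrow> Ct M (f a) (f b)) \<and>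
        (Bf A a b \<longleftrightarrow> Bf M (f a) (f b))) \<and>
     dense_in M (f ` carrier A) \<and>
     (\<forall>R \<in> {Cs M, Ct M, Bf M}. separable_in M R (f ` carrier A))"


section \<open>Well-definedness\<close>

lemma openin_clan_topology:
  assumes "boolean_lattice A"
  shows "openin (clan_topology A) =
    (arbitrary union_of (\<lambda>U. \<exists>a\<in>carrier A. U = t_clans A - g A a))"
proof -
  interpret boolean_lattice A by fact
  have un: "g A a \<union> g A b = g A (a \<squnion>\<^bsub>A\<^esub> b)"
    if "a \<in> carrier A" "b \<in> carrier A" for a b
    using that join_left[OF that] join_right[OF that] join_closed[OF that]
    unfolding g_def t_clans_def clan_def by blast
  have "istopology (arbitrary union_of (\<lambda>U. \<exists>a\<in>carrier A. U = t_clans A - g A a))"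
  proof (rule istopology_base)
    fix S T
    assume "\<exists>a\<in>carrier A. S = t_clans A - g A a" "\<exists>a\<in>carrier A. T = t_clans A - g A a"
    then obtain a b where "a \<in> carrier A" "b \<in> carrier A"
      "S = t_clans A - g A a" "T = t_clans A - g A b" by blast
    then show "\<exists>a\<in>carrier A. S \<inter> T = t_clans A - g A a"
      by (intro bexI[of _ "a \<squnion>\<^bsub>A\<^esub> b"]) (auto simp: un[symmetric])
  qed
  then show ?thesis
    unfolding clan_topology_def by (simp add: topology_inverse')
qed

lemma topspace_clan_topology:
  assumes "boolean_lattice A"
  shows "topspace (clan_topology A) = t_clans A"
proof -
  interpret boolean_lattice A by fact
  have "t_clans A - g A \<bottom>\<^bsub>A\<^esub> = t_clans A"
    by (auto simp: g_def t_clans_def clan_def)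
  then have "openin (clan_topology A) (t_clans A)"
    unfolding openin_clan_topology[OF assms]
    by (intro arbitrary_union_of_inc) (auto intro: bexI[of _ "\<bottom>\<^bsub>A\<^esub>"])
  moreover have "U \<subseteq> t_clans A" if "openin (clan_topology A) U" for U
    using that unfolding openin_clan_topology[OF assms] union_of_def by blast
  ultimately show ?thesis
    by (metis openin_subset openin_topspace subset_antisym)
qed

lemma trivial_dca_of_simps [simp]:
  "carrier (trivial_dca_of L C) = carrier L"
  "eq (trivial_dca_of L C) = eq L"
  "le (trivial_dca_of L C) = le L"
  "Cs (trivial_dca_of L C) = C"
  "Ct (trivial_dca_of L C) = (\<lambda>a b. a \<noteq> \<bottom>\<^bsub>L\<^esub> \<and> b \<noteq> \<bottom>\<^bsub>L\<^esub>)"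
  "Bf (trivial_dca_of L C) = (\<lambda>a b. a \<noteq> \<bottom>\<^bsub>L\<^esub> \<and> b \<noteq> \<bottom>\<^bsub>L\<^esub>)"
  by (simp_all add: trivial_dca_of_def gorder.defs dyn_struct.defs)

lemma trivial_dca_of_ops [simp]:
  "\<bottom>\<^bsub>trivial_dca_of L C\<^esub> = \<bottom>\<^bsub>L\<^esub>"
  "\<top>\<^bsub>trivial_dca_of L C\<^esub> = \<top>\<^bsub>L\<^esub>"
  "x \<squnion>\<^bsub>trivial_dca_of L C\<^esub> y = x \<squnion>\<^bsub>L\<^esub> y"
  "x \<sqinter>\<^bsub>trivial_dca_of L C\<^esub> y = x \<sqinter>\<^bsub>L\<^esub> y"
  "compl (trivial_dca_of L C) x = compl L x"
  by (simp_all add: bottom_def top_def join_def meet_def Lattice.sup_def Lattice.inf_def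
      least_def greatest_def Upper_def Lower_def elem_def compl_def)

lemma boolean_lattice_trivial_dca_of:
  "boolean_lattice (trivial_dca_of L C) \<longleftrightarrow> boolean_lattice L"
  by (simp add: boolean_lattice_def boolean_lattice_axioms_def bounded_lattice_def lattice_def
      upper_semilattice_def lower_semilattice_def upper_semilattice_axioms_def
      lower_semilattice_axioms_def weak_partial_order_bottom_def
      weak_partial_order_bottom_axioms_def weak_partial_order_top_def
      weak_partial_order_top_axioms_def partial_order_def partial_order_axioms_def
      weak_partial_order_def weak_partial_order_axioms_def equivalence_def
      least_def greatest_def Upper_def Lower_def elem_def)

lemma (in boolean_lattice) compl_bottom: "compl L \<bottom> = \<top>"
  unfolding compl_def
proof (rule the_equality)
  show "\<top> \<in> carrier L \<and> \<bottom> \<squnion> \<top> = \<top> \<and> \<bottom> \<sqinter> \<top> = \<bottom>"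
    using bottom_join[OF top_closed] bottom_meet[OF top_closed] by (simp add: eq_is_equal)
next
  fix y assume "y \<in> carrier L \<and> \<bottom> \<squnion> y = \<top> \<and> \<bottom> \<sqinter> y = \<bottom>"
  then show "y = \<top>" using bottom_join[of y] by (simp add: eq_is_equal)
qed

lemma (in boolean_lattice) compl_top: "compl L \<top> = \<bottom>"
  unfolding compl_def
proof (rule the_equality)
  show "\<bottom> \<in> carrier L \<and> \<top> \<squnion> \<bottom> = \<top> \<and> \<top> \<sqinter> \<bottom> = \<bottom>"
    using top_join[OF bottom_closed] top_meet[OF bottom_closed] by (simp add: eq_is_equal)
next
  fix y assume "y \<in> carrier L \<and> \<top> \<squnion> y = \<top> \<and> \<top> \<sqinter> y = \<bottom>"
  then show "y = \<bottom>" using top_meet[of y] by (simp add: eq_is_equal)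
qed

lemma trivial_dca_trivial_dca_of:
  fixes L (structure)
  assumes "contact_algebra L C"
  shows "trivial_dca (trivial_dca_of L C)"
proof -
  interpret boolean_lattice L
    using assms by (simp add: contact_algebra_def)
  let ?A = "trivial_dca_of L C"
  let ?D = "\<lambda>a b. a \<noteq> \<bottom> \<and> b \<noteq> \<bottom>"
  have transfer: "precontact ?A R = precontact L R" "contact ?A R = contact L R" for R
    by (simp_all add: precontact_def contact_def)
  have C: "contact L C"
    using assms by (simp add: contact_algebra_def)
  have le_bot: "a = \<bottom>" if "a \<sqsubseteq> \<bottom>" "a \<in> carrier L" for a
    using that by (intro le_antisym) auto
  have bot: "\<bottom> \<squnion> \<bottom> = \<bottom>" "a \<in> carrier L \<Longrightarrow> \<bottom> \<sqinter> a = \<bottom>"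
    "a \<in> carrier L \<Longrightarrow> a \<sqinter> \<bottom> = \<bottom>" for a
    using bottom_join[OF bottom_closed] bottom_meet[of a] meet_comm[of L a]
    by (auto simp: eq_is_equal)
  have pre: "precontact L ?D"
    unfolding precontact_def
  proof (intro conjI ballI impI)
    fix a b a' b' assume "a \<in> carrier L" "b \<in> carrier L"
      and "?D a b \<and> a \<sqsubseteq> a' \<and> b \<sqsubseteq> b'"
    then show "a' \<noteq> \<bottom>" "b' \<noteq> \<bottom>" using le_bot by auto
  next
    fix a b c assume "?D a (b \<squnion> c)"
    then show "?D a b \<or> ?D a c" using bot(1) by metis
  next
    fix a b c assume "?D (a \<squnion> b) c"
    then show "?D a c \<or> ?D b c" using bot(1) by metis
  qed blast+
  have con: "contact L ?D"
    unfolding contact_def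
  proof (intro conjI ballI impI)
    fix a b assume "a \<in> carrier L" "b \<in> carrier L" "a \<sqinter> b \<noteq> \<bottom>"
    then show "a \<noteq> \<bottom>" "b \<noteq> \<bottom>" using bot(2,3) by blast+
  qed (use pre in blast)+
  have "precontact L C"
    using C by (simp only: contact_def)
  then have sub: "\<forall>a\<in>carrier L. \<forall>b\<in>carrier L. C a b \<longrightarrow> ?D a b"
    unfolding precontact_def by (rule conjunct1)
  have interp: "\<exists>c\<in>carrier L. \<not> ?D a c \<and> \<not> ?D (compl L c) b"
    if "\<not> ?D a b" for a b
  proof (cases "a = \<bottom>")
    case True
    with compl_top show ?thesis by (intro bexI[of _ "\<top>"] top_closed) simp
  next
    case False
    with that have "b = \<bottom>" by simp
    with compl_bottom show ?thesis by (intro bexI[of _ "\<bottom>"] bottom_closed) simp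
  qed
  then have itp: "\<forall>a\<in>carrier L. \<forall>b\<in>carrier L. \<not> ?D a b \<longrightarrow>
      (\<exists>c\<in>carrier L. \<not> ?D a c \<and> \<not> ?D (compl L c) b)"
    by (intro ballI impI)
  have all: "\<forall>a\<in>carrier L. \<forall>b\<in>carrier L. ?D a b \<longrightarrow> ?D a b \<and> ?D a b"
    by simp
  have bl: "boolean_lattice L"
    using assms by (simp only: contact_algebra_def)
  show ?thesis
    unfolding trivial_dca_def dca_def transfer boolean_lattice_trivial_dca_of
      trivial_dca_of_simps trivial_dca_of_ops
    by (intro conjI) (fact bl C pre con sub itp all)+
qed

end

theory Submission
  imports Defs
begin

text \<open>
  In a trivial dynamic contact algebra any two nonzero elements are in time contact, so the
  t-clans are simply the grills, and \<open>g (compl a)\<close> is the closure of the complement of \<open>g a\<close>;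
  hence \<open>g\<close> embeds the algebra densely into the regular closed sets. By density every nonempty
  regular closed set contains the grill of all nonzero elements, which trivialises \<open>Ct\<close> and
  \<open>Bf\<close>, and it contains an s-clan. For separability of \<open>Cs\<close>, the elements \<open>x\<close> with
  \<open>c \<subseteq> g x\<close> form a filter determining \<open>c\<close>; if no member of the filter of \<open>a\<close> is
  separated from a member of the filter of \<open>b\<close>, then both filters extend to prime filters in
  contact, whose union is an s-clan lying in \<open>a \<inter> b\<close>.
\<close>

section \<open>Prime filters and clans in Boolean lattices\<close>

context boolean_lattice
begin

section \<open>Complements and De Morgan's law\<close>

lemma le_bottom: "x \<in> carrier L \<Longrightarrow> x \<sqsubseteq> \<bottom> \<Longrightarrow> x = \<bottom>"
  by (meson bottom_closed bottom_lower le_antisym)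

lemma bottom_join_eq: "x \<in> carrier L \<Longrightarrow> \<bottom> \<squnion> x = x"
  using bottom_join by (simp add: eq_is_equal)

lemma top_meet_eq: "x \<in> carrier L \<Longrightarrow> \<top> \<sqinter> x = x"
  using top_meet by (simp add: eq_is_equal)

text \<open>Distributivity splits \<open>z\<close> into its parts below \<open>x\<close> and below
  \<open>y\<close>, and the first part vanishes. Both uniqueness of complements and
  \<open>compl_le_iff\<close> come from this.\<close>

lemma le_of_cover:
  assumes "x \<in> carrier L" "y \<in> carrier L" "z \<in> carrier L"
    and "x \<squnion> y = \<top>" "z \<sqinter> x = \<bottom>"
  shows "z \<sqsubseteq> y"
proof -
  have "z = z \<sqinter> (x \<squnion> y)"
    using assms top_meet_eq[of z] meet_comm[of L z "\<top>"] by simp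
  also have "\<dots> = z \<sqinter> y"
    using assms distrib[of z x y] bottom_join_eq by simp
  finally show ?thesis
    using assms meet_right by metis
qed

lemma compl_unique:
  assumes "x \<in> carrier L" "y \<in> carrier L" "x \<squnion> y = \<top>" "x \<sqinter> y = \<bottom>"
  shows "compl L x = y"
  unfolding compl_def
proof (rule the_equality)
  show "y \<in> carrier L \<and> x \<squnion> y = \<top> \<and> x \<sqinter> y = \<bottom>"
    using assms by simp
next
  fix z assume "z \<in> carrier L \<and> x \<squnion> z = \<top> \<and> x \<sqinter> z = \<bottom>"
  then show "z = y"
    using assms le_of_cover[of x] meet_comm[of L] by (metis le_antisym)
qed

lemma compl_props:
  assumes "x \<in> carrier L"
  shows compl_closed: "compl L x \<in> carrier L"
    and join_compl: "x \<squnion> compl L x = \<top>"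
    and meet_compl: "x \<sqinter> compl L x = \<bottom>"
  using complemented[OF assms] compl_unique[OF assms] by auto

lemma compl_compl: "x \<in> carrier L \<Longrightarrow> compl L (compl L x) = x"
  by (metis compl_unique compl_closed join_compl meet_compl join_comm meet_comm)

text \<open>Translates covers of \<open>\<top>\<close> into inequalities, for use in
  \<open>compl_anti\<close> and \<open>closure_of_Diff_g\<close>.\<close>

lemma compl_le_iff:
  assumes "x \<in> carrier L" "y \<in> carrier L"
  shows "compl L x \<sqsubseteq> y \<longleftrightarrow> x \<squnion> y = \<top>"
proof
  assume "compl L x \<sqsubseteq> y"
  then have "x \<squnion> compl L x \<sqsubseteq> x \<squnion> y"
    using assms compl_closed
    by (meson join_closed join_le join_left join_right le_trans)
  then show "x \<squnion> y = \<top>"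
    using assms join_compl by (metis join_closed le_antisym top_closed top_higher)
next
  assume "x \<squnion> y = \<top>"
  then show "compl L x \<sqsubseteq> y"
    using assms le_of_cover[of x y "compl L x"] meet_compl compl_closed meet_comm by metis
qed

text \<open>Both inequalities amount to the same cover: \<open>y\<close> and
  \<open>compl L x\<close> join to \<open>\<top>\<close>.\<close>

lemma compl_anti:
  assumes "x \<in> carrier L" "y \<in> carrier L" "x \<sqsubseteq> y"
  shows "compl L y \<sqsubseteq> compl L x"
  using assms compl_le_iff[of y "compl L x"] compl_le_iff[of "compl L x" y]
  by (metis compl_closed compl_compl join_comm)

text \<open>In \<open>boolean_hom_g\<close> this derives preservation of meets from joins and
  complements, so that the closure of the interior of an intersection never has to be computed for
  \<open>g\<close>.\<close>

lemma meet_eq_compl_join_compl: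
  assumes x: "x \<in> carrier L" and y: "y \<in> carrier L"
  shows "x \<sqinter> y = compl L (compl L x \<squnion> compl L y)"
proof (rule le_antisym)
  let ?c = "compl L x \<squnion> compl L y"
  note cl = x y compl_closed[OF x] compl_closed[OF y]
  have c: "?c \<in> carrier L" "compl L ?c \<in> carrier L" "x \<sqinter> y \<in> carrier L"
    using cl compl_closed by auto
  then show "x \<sqinter> y \<in> carrier L" "compl L ?c \<in> carrier L" by auto
  have "compl L ?c \<sqsubseteq> x" "compl L ?c \<sqsubseteq> y"
    using compl_anti[OF _ c(1) join_left] compl_anti[OF _ c(1) join_right] cl compl_compl
    by metis+
  then show "compl L ?c \<sqsubseteq> x \<sqinter> y"
    using meet_le c cl by blast
  have "compl L x \<sqsubseteq> compl L (x \<sqinter> y)" "compl L y \<sqsubseteq> compl L (x \<sqinter> y)"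
    using compl_anti[OF c(3) x meet_left[OF x y]] compl_anti[OF c(3) y meet_right[OF x y]]
    by blast+
  then have "?c \<sqsubseteq> compl L (x \<sqinter> y)"
    using join_le cl compl_closed[OF c(3)] by blast
  then have "compl L (compl L (x \<sqinter> y)) \<sqsubseteq> compl L ?c"
    using compl_anti[OF c(1) compl_closed[OF c(3)]] by blast
  then show "x \<sqinter> y \<sqsubseteq> compl L ?c"
    using compl_compl c by simp
qed

end

section \<open>Filters, ideals and the prime filter theorem\<close>

definition filter_on :: "('a, 'm) gorder_scheme \<Rightarrow> 'a set \<Rightarrow> bool" where
  "filter_on L F \<longleftrightarrow> F \<subseteq> carrier L \<and> \<top>\<^bsub>L\<^esub> \<in> F \<and>
     (\<forall>a\<in>F. \<forall>b\<in>carrier L. a \<sqsubseteq>\<^bsub>L\<^esub> b \<longrightarrow> b \<in> F) \<and>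
     (\<forall>a\<in>F. \<forall>b\<in>F. a \<sqinter>\<^bsub>L\<^esub> b \<in> F)"

definition prime_filter_on :: "('a, 'm) gorder_scheme \<Rightarrow> 'a set \<Rightarrow> bool" where
  "prime_filter_on L F \<longleftrightarrow> filter_on L F \<and> \<bottom>\<^bsub>L\<^esub> \<notin> F \<and>
     (\<forall>a\<in>carrier L. \<forall>b\<in>carrier L. a \<squnion>\<^bsub>L\<^esub> b \<in> F \<longrightarrow> a \<in> F \<or> b \<in> F)"

definition ideal_on :: "('a, 'm) gorder_scheme \<Rightarrow> 'a set \<Rightarrow> bool" where
  "ideal_on L I \<longleftrightarrow> I \<subseteq> carrier L \<and> \<bottom>\<^bsub>L\<^esub> \<in> I \<and>
     (\<forall>a\<in>I. \<forall>b\<in>carrier L. b \<sqsubseteq>\<^bsub>L\<^esub> a \<longrightarrow> b \<in> I) \<and>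
     (\<forall>a\<in>I. \<forall>b\<in>I. a \<squnion>\<^bsub>L\<^esub> b \<in> I)"

context boolean_lattice
begin

lemma filter_on_principal:
  "a \<in> carrier L \<Longrightarrow> filter_on L {x \<in> carrier L. a \<sqsubseteq> x}"
  unfolding filter_on_def by (auto intro: le_trans meet_le)

text \<open>This is the filter generated by \<open>F\<close> and \<open>x\<close>, by which a
  maximal filter would grow. If \<open>u\<close> and \<open>v\<close> witness two members, then
  \<open>u \<sqinter> v\<close> witnesses their meet.\<close>

lemma filter_on_adjoin:
  assumes F: "filter_on L F" and x: "x \<in> carrier L"
  shows "filter_on L {z \<in> carrier L. \<exists>u\<in>F. u \<sqinter> x \<sqsubseteq> z}" (is "filter_on L ?G")
proof -
  have sub: "F \<subseteq> carrier L" and top: "\<top> \<in> F"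
    and meet: "\<And>a b. a \<in> F \<Longrightarrow> b \<in> F \<Longrightarrow> a \<sqinter> b \<in> F"
    using F unfolding filter_on_def by auto
  have "b \<in> ?G" if "a \<in> ?G" "b \<in> carrier L" "a \<sqsubseteq> b" for a b
    using that sub x by (blast intro: le_trans meet_closed)
  moreover have "a \<sqinter> b \<in> ?G" if ab: "a \<in> ?G" "b \<in> ?G" for a b
  proof -
    obtain u v where uv: "u \<in> F" "v \<in> F" and le: "u \<sqinter> x \<sqsubseteq> a" "v \<sqinter> x \<sqsubseteq> b"
      using ab by blast
    have "u \<in> carrier L" "v \<in> carrier L" "a \<in> carrier L" "b \<in> carrier L"
      using uv sub ab by blast+
    then have c: "u \<in> carrier L" "v \<in> carrier L" "u \<sqinter> v \<in> carrier L"
      "(u \<sqinter> v) \<sqinter> x \<in> carrier L" "a \<in> carrier L" "b \<in> carrier L"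
      using x by simp_all
    have "(u \<sqinter> v) \<sqinter> x \<sqsubseteq> u" "(u \<sqinter> v) \<sqinter> x \<sqsubseteq> v" "(u \<sqinter> v) \<sqinter> x \<sqsubseteq> x"
      using c x by (meson le_trans meet_left meet_right)+
    then have "(u \<sqinter> v) \<sqinter> x \<sqsubseteq> u \<sqinter> x" "(u \<sqinter> v) \<sqinter> x \<sqsubseteq> v \<sqinter> x"
      using c x by (auto intro: meet_le)
    then have "(u \<sqinter> v) \<sqinter> x \<sqsubseteq> a \<sqinter> b"
      using c x le by (meson le_trans meet_closed meet_le)
    then show ?thesis using meet[OF uv] c by auto
  qed
  ultimately show ?thesis
    unfolding filter_on_def using top x by (auto intro!: bexI[OF _ top])
qed

text \<open>Zorn's lemma gives a filter \<open>U\<close> maximal among those that extend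
  \<open>F\<close> and avoid \<open>I\<close>. If \<open>a\<close> and \<open>b\<close> both lay
  outside \<open>U\<close> while \<open>a \<squnion> b\<close> lay inside, distributivity would
  produce an element of \<open>U \<inter> I\<close>.\<close>

theorem prime_filter_extension:
  assumes F: "filter_on L F" and I: "ideal_on L I" and disj: "F \<inter> I = {}"
  obtains U where "prime_filter_on L U" "F \<subseteq> U" "U \<inter> I = {}"
proof -
  let ?P = "{G. filter_on L G \<and> F \<subseteq> G \<and> G \<inter> I = {}}"
  have "\<exists>M\<in>?P. \<forall>X\<in>?P. M \<subseteq> X \<longrightarrow> X = M"
  proof (rule subset_Zorn_nonempty)
    show "?P \<noteq> {}" using F disj by blast
    fix \<C> assume ne: "\<C> \<noteq> {}" and chain: "subset.chain ?P \<C>"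
    then have sub: "\<And>G. G \<in> \<C> \<Longrightarrow> filter_on L G \<and> F \<subseteq> G \<and> G \<inter> I = {}"
      by (auto simp: subset_chain_def)
    have "a \<sqinter> b \<in> \<Union>\<C>" if ab: "a \<in> \<Union>\<C>" "b \<in> \<Union>\<C>" for a b
    proof -
      obtain G H where GH: "G \<in> \<C>" "H \<in> \<C>" "a \<in> G" "b \<in> H" using ab by blast
      then have "G \<subseteq> H \<or> H \<subseteq> G" using chain by (auto simp: subset_chain_def)
      then have "a \<in> H \<and> b \<in> H \<or> a \<in> G \<and> b \<in> G" using GH by blast
      then show ?thesis using sub GH unfolding filter_on_def by blast
    qed
    moreover have "b \<in> \<Union>\<C>" if "a \<in> \<Union>\<C>" "b \<in> carrier L" "a \<sqsubseteq> b" for a b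
      using that sub unfolding filter_on_def by blast
    moreover have "\<Union>\<C> \<subseteq> carrier L" "\<top> \<in> \<Union>\<C>"
      using sub ne unfolding filter_on_def by blast+
    ultimately have "filter_on L (\<Union>\<C>)"
      unfolding filter_on_def by blast
    then show "\<Union>\<C> \<in> ?P" using sub ne by blast
  qed
  then obtain U where U: "filter_on L U" and FU: "F \<subseteq> U" and UI: "U \<inter> I = {}"
    and max: "\<And>X. filter_on L X \<Longrightarrow> X \<inter> I = {} \<Longrightarrow> U \<subseteq> X \<Longrightarrow> X = U"
    by (smt (verit) mem_Collect_eq subset_trans)
  have sub: "U \<subseteq> carrier L" and top: "\<top> \<in> U"
    and up: "\<And>a b. a \<in> U \<Longrightarrow> b \<in> carrier L \<Longrightarrow> a \<sqsubseteq> b \<Longrightarrow> b \<in> U"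
    and meet: "\<And>a b. a \<in> U \<Longrightarrow> b \<in> U \<Longrightarrow> a \<sqinter> b \<in> U"
    using U unfolding filter_on_def by auto
  have Isub: "I \<subseteq> carrier L" and Ibot: "\<bottom> \<in> I"
    and down: "\<And>a b. a \<in> I \<Longrightarrow> b \<in> carrier L \<Longrightarrow> b \<sqsubseteq> a \<Longrightarrow> b \<in> I"
    and Ijoin: "\<And>a b. a \<in> I \<Longrightarrow> b \<in> I \<Longrightarrow> a \<squnion> b \<in> I"
    using I unfolding ideal_on_def by auto
  have meets_I: "\<exists>u\<in>U. u \<sqinter> x \<in> I" if x: "x \<in> carrier L" "x \<notin> U" for x
  proof (rule ccontr)
    assume no: "\<not> ?thesis"
    \<comment> \<open>Under the assumption \<open>no\<close>, adjoining \<open>x\<close> to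
      \<open>U\<close> still avoids \<open>I\<close>, so maximality puts \<open>x\<close> into
      \<open>U\<close>.\<close>
    let ?G = "{z \<in> carrier L. \<exists>u\<in>U. u \<sqinter> x \<sqsubseteq> z}"
    have "?G \<inter> I = {}"
      using no down x sub meet_closed by (force simp: disjoint_iff)
    moreover have "U \<subseteq> ?G"
      using sub x meet_left by blast
    ultimately have "?G = U"
      using max filter_on_adjoin[OF U x(1)] by blast
    moreover have "x \<in> ?G"
      using x top meet_right by blast
    ultimately show False using x by blast
  qed
  have "a \<in> U \<or> b \<in> U" if ab: "a \<in> carrier L" "b \<in> carrier L" "a \<squnion> b \<in> U" for a b
  proof (rule ccontr)
    assume "\<not> ?thesis"
    then obtain u v where uv: "u \<in> U" "v \<in> U" "u \<sqinter> a \<in> I" "v \<sqinter> b \<in> I"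
      using meets_I ab by blast
    \<comment> \<open>A common witness: passing to the smaller \<open>w\<close> keeps both
      \<open>w \<sqinter> a\<close> and \<open>w \<sqinter> b\<close> in the ideal.\<close>
    define w where "w = u \<sqinter> v"
    have c: "u \<in> carrier L" "v \<in> carrier L" "w \<in> carrier L" "w \<in> U"
      using uv sub meet w_def by auto
    have "w \<sqinter> a \<in> carrier L" "w \<sqinter> b \<in> carrier L"
      using c ab by simp_all
    moreover have "w \<sqsubseteq> u" "w \<sqsubseteq> v"
      using c unfolding w_def by (simp_all add: meet_left meet_right)
    ultimately have "w \<sqinter> a \<sqsubseteq> u" "w \<sqinter> b \<sqsubseteq> v"
      using c ab meet_left[of w] by (blast intro: le_trans)+
    then have "w \<sqinter> a \<sqsubseteq> u \<sqinter> a" "w \<sqinter> b \<sqsubseteq> v \<sqinter> b"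
      using c ab by (auto intro: meet_le meet_right)
    then have "w \<sqinter> a \<in> I" "w \<sqinter> b \<in> I"
      using down[OF uv(3)] down[OF uv(4)] c ab by simp_all
    then have "w \<sqinter> (a \<squnion> b) \<in> I"
      using Ijoin distrib c ab by simp
    moreover have "w \<sqinter> (a \<squnion> b) \<in> U"
      using meet c ab by blast
    ultimately show False using UI by blast
  qed
  then have "prime_filter_on L U"
    unfolding prime_filter_on_def using U UI Ibot by blast
  then show thesis using that FU UI by blast
qed

section \<open>Extending filters in contact to a clan\<close>

lemma precontact_nonbottom:
  assumes "precontact L C" "a \<in> carrier L" "b \<in> carrier L" "C a b"
  shows "a \<noteq> \<bottom> \<and> b \<noteq> \<bottom>"
proof -
  have "\<forall>a\<in>carrier L. \<forall>b\<in>carrier L. C a b \<longrightarrow> a \<noteq> \<bottom> \<and> b \<noteq> \<bottom>"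
    using assms(1) unfolding precontact_def by (rule conjunct1)
  then show ?thesis using assms(2-4) by blast
qed

lemma precontact_mono:
  assumes "precontact L C" "C a b" "a \<sqsubseteq> a'" "b \<sqsubseteq> b'"
    and "a \<in> carrier L" "b \<in> carrier L" "a' \<in> carrier L" "b' \<in> carrier L"
  shows "C a' b'"
  using assms unfolding precontact_def by blast

text \<open>The elements out of contact with some member of \<open>G\<close> form an ideal.\<close>

lemma prime_filter_extension_contact:
  assumes C: "precontact L C" and F: "filter_on L F" and G: "filter_on L G"
    and FG: "\<And>a b. a \<in> F \<Longrightarrow> b \<in> G \<Longrightarrow> C a b"
  obtains U where "prime_filter_on L U" "F \<subseteq> U" "\<And>a b. a \<in> U \<Longrightarrow> b \<in> G \<Longrightarrow> C a b"
proof -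
  define I where "I = {b \<in> carrier L. \<exists>c\<in>G. \<not> C b c}"
  have Gsub: "G \<subseteq> carrier L" and Gtop: "\<top> \<in> G"
    and Gmeet: "\<And>a b. a \<in> G \<Longrightarrow> b \<in> G \<Longrightarrow> a \<sqinter> b \<in> G"
    using G unfolding filter_on_def by auto
  have "\<not> C \<bottom> \<top>"
    using C unfolding precontact_def by auto
  then have bot: "\<bottom> \<in> I"
    using Gtop by (auto simp: I_def)
  have down: "b \<in> I" if "a \<in> I" "b \<in> carrier L" "b \<sqsubseteq> a" for a b
    using that Gsub precontact_mono[OF C] unfolding I_def by blast
  have join: "a \<squnion> b \<in> I" if ab: "a \<in> I" "b \<in> I" for a b
  proof -
    obtain c d where cd: "c \<in> G" "d \<in> G" "\<not> C a c" "\<not> C b d"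
      and car: "a \<in> carrier L" "b \<in> carrier L"
      using ab unfolding I_def by blast
    have cd': "c \<in> carrier L" "d \<in> carrier L"
      using cd Gsub by blast+
    then have "c \<sqinter> d \<in> carrier L" by simp
    \<comment> \<open>By monotonicity the single element \<open>c \<sqinter> d\<close> of
      \<open>G\<close> is out of contact with both \<open>a\<close> and \<open>b\<close>, so
      additivity of \<open>C\<close> applies to their join.\<close>
    then have "\<not> C a (c \<sqinter> d)" "\<not> C b (c \<sqinter> d)"
      using precontact_mono[OF C _ le_refl[OF car(1)] meet_left[OF cd']]
        precontact_mono[OF C _ le_refl[OF car(2)] meet_right[OF cd']] cd cd' car
      by blast+
    then have "\<not> C (a \<squnion> b) (c \<sqinter> d)"
      using C car \<open>c \<sqinter> d \<in> carrier L\<close> unfolding precontact_def by blast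
    then show ?thesis
      using Gmeet cd car by (auto simp: I_def)
  qed
  have I: "ideal_on L I"
    unfolding ideal_on_def using bot down join I_def by blast
  have "F \<inter> I = {}" using FG unfolding I_def by blast
  from prime_filter_extension[OF F I this]
  obtain U where U: "prime_filter_on L U" "F \<subseteq> U" "U \<inter> I = {}" .
  have "U \<subseteq> carrier L"
    using U(1) unfolding prime_filter_on_def filter_on_def by blast
  then have "C a b" if "a \<in> U" "b \<in> G" for a b
    using U(3) that unfolding I_def by blast
  then show thesis using that U by blast
qed

text \<open>First \<open>F\<close> grows to a prime filter \<open>U\<close> in contact with
  \<open>G\<close>, then \<open>G\<close> grows to a prime filter \<open>V\<close> in contact with
  \<open>U\<close>. The union of two prime filters is still upward closed and prime for joins, which
  together with pairwise contact is what a clan requires.\<close>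

theorem clan_extension:
  assumes C: "contact L C" and F: "filter_on L F" and G: "filter_on L G"
    and FG: "\<And>a b. a \<in> F \<Longrightarrow> b \<in> G \<Longrightarrow> C a b"
  obtains \<Gamma> where "clan L C \<Gamma>" "F \<subseteq> \<Gamma>" "G \<subseteq> \<Gamma>"
proof -
  have pre: "precontact L C"
    and sym: "\<And>a b. a \<in> carrier L \<Longrightarrow> b \<in> carrier L \<Longrightarrow> C a b \<Longrightarrow> C b a"
    and overlap: "\<And>a b. a \<in> carrier L \<Longrightarrow> b \<in> carrier L \<Longrightarrow> a \<sqinter> b \<noteq> \<bottom> \<Longrightarrow> C a b"
    using C unfolding contact_def by auto
  obtain U where U: "prime_filter_on L U" "F \<subseteq> U" and UG: "\<And>a b. a \<in> U \<Longrightarrow> b \<in> G \<Longrightarrow> C a b"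
    using prime_filter_extension_contact[OF pre F G FG] by blast
  have Uf: "filter_on L U" and Us: "U \<subseteq> carrier L"
    using U(1) unfolding prime_filter_on_def filter_on_def by blast+
  \<comment> \<open>Symmetry of \<open>C\<close> exchanges the two sides, so that the extension
    lemma can now enlarge \<open>G\<close> against \<open>U\<close>.\<close>
  have "C b a" if "b \<in> G" "a \<in> U" for a b
    using UG[OF that(2,1)] that G Us sym unfolding filter_on_def by blast
  then obtain V where V: "prime_filter_on L V" "G \<subseteq> V"
    and VU: "\<And>a b. a \<in> V \<Longrightarrow> b \<in> U \<Longrightarrow> C a b"
    using prime_filter_extension_contact[OF pre G Uf] by blast
  have Vs: "V \<subseteq> carrier L"
    using V(1) unfolding prime_filter_on_def filter_on_def by blast
  \<comment> \<open>Two members of one prime filter have a nonzero meet, so the overlap axiom puts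
    them in contact.\<close>
  have self: "C a b" if "prime_filter_on L W" "a \<in> W" "b \<in> W" for W a b
    using that overlap unfolding prime_filter_on_def filter_on_def by (metis subsetD)
  have "C a b" if ab: "a \<in> U \<union> V" "b \<in> U \<union> V" for a b
  proof -
    have "C a b" if "a \<in> U" "b \<in> V"
      using VU[OF that(2,1)] sym that Us Vs by blast
    then show ?thesis
      using ab self[OF U(1)] self[OF V(1)] VU by blast
  qed
  then have "clan L C (U \<union> V)"
    using U(1) V(1) unfolding clan_def prime_filter_on_def filter_on_def by blast
  then show thesis using that U V by blast
qed

end

section \<open>The Boolean lattice of regular closed sets\<close>

definition regular_closed :: "'p topology \<Rightarrow> 'p set \<Rightarrow> bool" where
  "regular_closed X a \<longleftrightarrow> X closure_of (X interior_of a) = a"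

lemma regular_closed_imp_closedin: "regular_closed X a \<Longrightarrow> closedin X a"
  unfolding regular_closed_def by (metis closedin_closure_of)

lemma regular_closed_closure_of:
  assumes "openin X U" shows "regular_closed X (X closure_of U)"
  unfolding regular_closed_def
proof (rule antisym)
  show "X closure_of (X interior_of (X closure_of U)) \<subseteq> X closure_of U"
    by (metis closure_of_closure_of closure_of_mono interior_of_subset)
  show "X closure_of U \<subseteq> X closure_of (X interior_of (X closure_of U))"
    using assms by (intro closure_of_mono interior_of_maximal)
      (auto simp: closure_of_subset openin_subset)
qed

text \<open>The interior of a union may exceed the union of the interiors, but closures absorb the
  difference. The part of the interior of \<open>a \<union> b\<close> outside \<open>a\<close> is
  open and inside \<open>b\<close>, hence in the interior of \<open>b\<close>. So the part outside
  \<open>?W\<close> lies in \<open>a\<close> and, being open, in the interior of \<open>a\<close>.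
  Distributivity of \<open>RC\<close> rests on this.\<close>

lemma closure_of_interior_of_Un:
  assumes "closedin X a" "closedin X b"
  shows "X closure_of (X interior_of (a \<union> b)) =
    X closure_of (X interior_of a) \<union> X closure_of (X interior_of b)"
proof (rule antisym)
  let ?U = "X interior_of (a \<union> b)" and ?W = "X closure_of (X interior_of b)"
  have "openin X (?U - a)"
    using assms(1) by (simp add: openin_diff)
  moreover have "?U - a \<subseteq> b"
    using interior_of_subset by fastforce
  ultimately have Ub: "?U - a \<subseteq> X interior_of b"
    by (simp add: interior_of_maximal)
  then have "?U - ?W \<subseteq> a"
    using closure_of_subset[OF interior_of_subset_topspace[of X b]] by blast
  moreover have "openin X (?U - ?W)"
    by (simp add: openin_diff)
  ultimately have "?U - ?W \<subseteq> X interior_of a"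
    by (simp add: interior_of_maximal)
  then have "?U \<subseteq> X closure_of (X interior_of a) \<union> ?W"
    using closure_of_subset[OF interior_of_subset_topspace[of X a]] by blast
  then show "X closure_of ?U \<subseteq> X closure_of (X interior_of a) \<union> ?W"
    by (simp add: closure_of_minimal closedin_Un)
  show "X closure_of (X interior_of a) \<union> ?W \<subseteq> X closure_of ?U"
    by (simp add: closure_of_mono interior_of_mono)
qed

lemma regular_closed_Un:
  "regular_closed X a \<Longrightarrow> regular_closed X b \<Longrightarrow> regular_closed X (a \<union> b)"
  using closure_of_interior_of_Un[of X a b] regular_closed_imp_closedin[of X]
  by (simp add: regular_closed_def)

text \<open>Applied to an intersection, it places every regular closed lower bound below the
  candidate for the meet.\<close>

lemma regular_closed_subset_closure_of_interior_of:
  assumes "regular_closed X c" "c \<subseteq> a" shows "c \<subseteq> X closure_of (X interior_of a)"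
  using assms unfolding regular_closed_def by (metis closure_of_mono interior_of_mono)

section \<open>Lattice operations and complements on regular closed sets\<close>

lemma RC_simps [simp]:
  "eq (RC S) = (=)" "le (RC S) = (\<subseteq>)"
  "Cs (RC S) = (\<lambda>a b. a \<inter> b \<inter> space_pts S \<noteq> {})"
  "Ct (RC S) = (\<lambda>a b. a \<inter> b \<noteq> {})"
  "Bf (RC S) = (\<lambda>a b. \<exists>x\<in>a. \<exists>y\<in>b. before S x y)"
  by (simp_all add: RC_def)

lemma carrier_RC: "carrier (RC S) = {a. regular_closed (time_space S) a}"
  using closure_of_subset_topspace by (fastforce simp: RC_def regular_closed_def)

lemma partial_order_RC: "partial_order (RC S)"
  by unfold_locales (auto simp: carrier_RC)

lemma least_RC_Un:
  assumes "a \<in> carrier (RC S)" "b \<in> carrier (RC S)"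
  shows "least (RC S) (a \<union> b) (Upper (RC S) {a, b})"
  using assms regular_closed_Un by (auto simp: least_def Upper_def carrier_RC)

lemma greatest_RC_Int:
  assumes "a \<in> carrier (RC S)" "b \<in> carrier (RC S)"
  shows "greatest (RC S) (time_space S closure_of (time_space S interior_of (a \<inter> b)))
    (Lower (RC S) {a, b})"
proof -
  let ?X = "time_space S"
  have ab: "closedin ?X (a \<inter> b)"
    using assms by (simp add: carrier_RC regular_closed_imp_closedin closedin_Int)
  have "?X closure_of (?X interior_of (a \<inter> b)) \<subseteq> a \<inter> b"
    by (rule closure_of_minimal[OF interior_of_subset ab])
  then show ?thesis
    using assms regular_closed_closure_of[OF openin_interior_of]
      regular_closed_subset_closure_of_interior_of[of ?X _ "a \<inter> b"]
    by (auto simp: greatest_def Lower_def carrier_RC)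
qed

lemma lattice_RC: "lattice (RC S)"
proof -
  interpret partial_order "RC S" by (rule partial_order_RC)
  show ?thesis
    by unfold_locales (use least_RC_Un greatest_RC_Int in blast)+
qed

lemma join_RC:
  assumes "a \<in> carrier (RC S)" "b \<in> carrier (RC S)"
  shows "a \<squnion>\<^bsub>RC S\<^esub> b = a \<union> b"
proof -
  interpret lattice "RC S" by (rule lattice_RC)
  show ?thesis
    unfolding join_def using least_unique[OF sup_of_two_least least_RC_Un] assms by blast
qed

lemma meet_RC:
  assumes "a \<in> carrier (RC S)" "b \<in> carrier (RC S)"
  shows "a \<sqinter>\<^bsub>RC S\<^esub> b = time_space S closure_of (time_space S interior_of (a \<inter> b))"
proof -
  interpret lattice "RC S" by (rule lattice_RC)
  show ?thesis
    unfolding meet_def using greatest_unique[OF inf_of_two_greatest greatest_RC_Int] assms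
    by blast
qed

lemma least_RC_empty: "least (RC S) {} (carrier (RC S))"
  by (auto simp: least_def carrier_RC regular_closed_def)

lemma greatest_RC_topspace: "greatest (RC S) (topspace (time_space S)) (carrier (RC S))"
  using closedin_subset[OF regular_closed_imp_closedin]
  by (auto simp: greatest_def carrier_RC regular_closed_def)

lemma bounded_lattice_RC: "bounded_lattice (RC S)"
proof -
  interpret lattice "RC S" by (rule lattice_RC)
  show ?thesis
    by unfold_locales (use least_RC_empty greatest_RC_topspace in blast)+
qed

lemma bottom_RC: "\<bottom>\<^bsub>RC S\<^esub> = {}"
proof -
  interpret bounded_lattice "RC S" by (rule bounded_lattice_RC)
  show ?thesis using least_unique[OF bottom_least least_RC_empty] .
qed

lemma top_RC: "\<top>\<^bsub>RC S\<^esub> = topspace (time_space S)"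
proof -
  interpret bounded_lattice "RC S" by (rule bounded_lattice_RC)
  show ?thesis using greatest_unique[OF top_greatest greatest_RC_topspace] .
qed

text \<open>The closure of the complement is the complement of the interior. Thus \<open>a\<close>
  and \<open>b\<close> may share boundary points, but their intersection has empty interior, and the
  meet is empty.\<close>

lemma RC_complement:
  assumes "a \<in> carrier (RC S)"
  defines "b \<equiv> time_space S closure_of (topspace (time_space S) - a)"
  shows "b \<in> carrier (RC S)" "a \<squnion>\<^bsub>RC S\<^esub> b = \<top>\<^bsub>RC S\<^esub>" "a \<sqinter>\<^bsub>RC S\<^esub> b = \<bottom>\<^bsub>RC S\<^esub>"
proof -
  let ?X = "time_space S"
  have a: "closedin ?X a"
    using assms by (simp add: carrier_RC regular_closed_imp_closedin)
  then show b: "b \<in> carrier (RC S)"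
    unfolding b_def carrier_RC mem_Collect_eq by (intro regular_closed_closure_of openin_diff) auto
  have b_eq: "b = topspace ?X - ?X interior_of a"
    by (simp only: b_def closure_of_complement)
  show "a \<squnion>\<^bsub>RC S\<^esub> b = \<top>\<^bsub>RC S\<^esub>"
    unfolding join_RC[OF assms(1) b] top_RC
    using b_eq closedin_subset[OF a] interior_of_subset[of ?X a] by blast
  have "?X interior_of (a \<inter> b) = {}"
    unfolding interior_of_Int using interior_of_subset[of ?X b] b_eq by blast
  then show "a \<sqinter>\<^bsub>RC S\<^esub> b = \<bottom>\<^bsub>RC S\<^esub>"
    by (simp add: meet_RC[OF assms(1) b] bottom_RC)
qed

lemma boolean_lattice_RC: "boolean_lattice (RC S)"
proof -
  interpret bounded_lattice "RC S" by (rule bounded_lattice_RC)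
  let ?X = "time_space S"
  show ?thesis
  proof unfold_locales
    fix x y z assume c: "x \<in> carrier (RC S)" "y \<in> carrier (RC S)" "z \<in> carrier (RC S)"
    have yz: "y \<squnion>\<^bsub>RC S\<^esub> z \<in> carrier (RC S)"
      and xy_xz: "x \<sqinter>\<^bsub>RC S\<^esub> y \<in> carrier (RC S)" "x \<sqinter>\<^bsub>RC S\<^esub> z \<in> carrier (RC S)"
      using c by simp_all
    have "closedin ?X (x \<inter> y)" "closedin ?X (x \<inter> z)"
      using c by (simp_all add: carrier_RC regular_closed_imp_closedin closedin_Int)
    then have "?X closure_of (?X interior_of (x \<inter> (y \<union> z))) =
        ?X closure_of (?X interior_of (x \<inter> y)) \<union> ?X closure_of (?X interior_of (x \<inter> z))"
      unfolding Int_Un_distrib by (rule closure_of_interior_of_Un)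
    then show "x \<sqinter>\<^bsub>RC S\<^esub> (y \<squnion>\<^bsub>RC S\<^esub> z) = (x \<sqinter>\<^bsub>RC S\<^esub> y) \<squnion>\<^bsub>RC S\<^esub> (x \<sqinter>\<^bsub>RC S\<^esub> z)"
      unfolding join_RC[OF xy_xz] meet_RC[OF c(1) yz]
      unfolding meet_RC[OF c(1,2)] meet_RC[OF c(1,3)] join_RC[OF c(2,3)] .
  next
    fix x assume "x \<in> carrier (RC S)"
    then show "\<exists>y\<in>carrier (RC S). x \<squnion>\<^bsub>RC S\<^esub> y = \<top>\<^bsub>RC S\<^esub> \<and> x \<sqinter>\<^bsub>RC S\<^esub> y = \<bottom>\<^bsub>RC S\<^esub>"
      using RC_complement[of x S] by blast
  qed
qed

lemma compl_RC:
  assumes "a \<in> carrier (RC S)"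
  shows "compl (RC S) a = time_space S closure_of (topspace (time_space S) - a)"
  by (rule boolean_lattice.compl_unique[OF boolean_lattice_RC assms RC_complement[OF assms]])

section \<open>The canonical space of a trivial dynamic contact algebra\<close>

text \<open>The argument is carried out for an arbitrary trivial dynamic contact algebra;
  \<open>trivial_dca_of L C\<close> is an instance.\<close>

locale trivial_dynamic_contact =
  fixes A :: "'a dyn_struct" (structure)
  assumes trivial: "trivial_dca A"

sublocale trivial_dynamic_contact \<subseteq> boolean_lattice A
  using trivial by (simp add: trivial_dca_def dca_def)

context trivial_dynamic_contact
begin

section \<open>Time contact, precedence and t-clans in a trivial algebra\<close>

lemma contact_Cs: "contact A (Cs A)" and precontact_Ct: "precontact A (Ct A)"
  and precontact_Bf: "precontact A (Bf A)"
  using trivial unfolding trivial_dca_def dca_def contact_def by blast+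

lemma Ct_iff: "a \<in> carrier A \<Longrightarrow> b \<in> carrier A \<Longrightarrow> Ct A a b \<longleftrightarrow> a \<noteq> \<bottom> \<and> b \<noteq> \<bottom>"
  using trivial precontact_nonbottom[OF precontact_Ct] unfolding trivial_dca_def by blast

lemma Bf_iff: "a \<in> carrier A \<Longrightarrow> b \<in> carrier A \<Longrightarrow> Bf A a b \<longleftrightarrow> a \<noteq> \<bottom> \<and> b \<noteq> \<bottom>"
  using trivial precontact_nonbottom[OF precontact_Bf] unfolding trivial_dca_def by blast

text \<open>Elements of a set that omits \<open>\<bottom>\<close> are pairwise in time contact by
  \<open>Ct_iff\<close>.\<close>

lemma t_clans_iff:
  "\<Gamma> \<in> t_clans A \<longleftrightarrow> \<Gamma> \<subseteq> carrier A \<and> \<top> \<in> \<Gamma> \<and> \<bottom> \<notin> \<Gamma> \<and>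
     (\<forall>a\<in>\<Gamma>. \<forall>b\<in>carrier A. a \<sqsubseteq> b \<longrightarrow> b \<in> \<Gamma>) \<and>
     (\<forall>a\<in>carrier A. \<forall>b\<in>carrier A. a \<squnion> b \<in> \<Gamma> \<longrightarrow> a \<in> \<Gamma> \<or> b \<in> \<Gamma>)"
proof -
  have "\<forall>a\<in>\<Gamma>. \<forall>b\<in>\<Gamma>. Ct A a b" if "\<Gamma> \<subseteq> carrier A" "\<bottom> \<notin> \<Gamma>"
    using that Ct_iff by (metis subsetD)
  then show ?thesis
    unfolding t_clans_def clan_def by blast
qed

lemma s_clans_subset_t_clans: "s_clans A \<subseteq> t_clans A"
  unfolding s_clans_def t_clans_iff subset_iff mem_Collect_eq clan_def by blast

lemma g_join:
  assumes "a \<in> carrier A" "b \<in> carrier A"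
  shows "g A (a \<squnion> b) = g A a \<union> g A b"
  using assms join_left[OF assms] join_right[OF assms] join_closed[OF assms]
  unfolding g_def t_clans_iff by blast

lemma g_mono: "b \<in> carrier A \<Longrightarrow> a \<sqsubseteq> b \<Longrightarrow> g A a \<subseteq> g A b"
  unfolding g_def t_clans_iff by blast

lemma g_bottom: "g A \<bottom> = {}" and g_top: "g A \<top> = t_clans A"
proof -
  have "\<bottom> \<notin> \<Gamma> \<and> \<top> \<in> \<Gamma>" if "\<Gamma> \<in> t_clans A" for \<Gamma>
    using that by (simp only: t_clans_iff simp_thms)
  then show "g A \<bottom> = {}" "g A \<top> = t_clans A"
    unfolding g_def by blast+
qed

text \<open>The complement of the principal ideal of \<open>c\<close> is a point that tests the
  order: it belongs to \<open>g A a\<close> exactly when \<open>a\<close> is not below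
  \<open>c\<close>.\<close>

lemma not_le_in_t_clans:
  assumes c: "c \<in> carrier A" "c \<noteq> \<top>"
  shows "{x \<in> carrier A. \<not> x \<sqsubseteq> c} \<in> t_clans A"
proof -
  have "\<not> \<top> \<sqsubseteq> c"
    using c by (meson le_antisym top_closed top_higher)
  moreover have "\<bottom> \<sqsubseteq> c"
    using c by simp
  ultimately show ?thesis
    unfolding t_clans_iff using c
    by (blast intro: le_trans join_le top_closed)
qed

lemma g_subset_iff:
  assumes "a \<in> carrier A" "b \<in> carrier A"
  shows "g A a \<subseteq> g A b \<longleftrightarrow> a \<sqsubseteq> b"
proof
  assume sub: "g A a \<subseteq> g A b"
  show "a \<sqsubseteq> b"
  proof (rule ccontr)
    assume nle: "\<not> a \<sqsubseteq> b"
    then have "b \<noteq> \<top>" using assms top_higher by blast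
    then have "{x \<in> carrier A. \<not> x \<sqsubseteq> b} \<in> g A a"
      using assms nle not_le_in_t_clans by (simp add: g_def)
    then have "{x \<in> carrier A. \<not> x \<sqsubseteq> b} \<in> g A b"
      using sub by blast
    then show False using assms by (simp add: g_def)
  qed
qed (rule g_mono[OF assms(2)])

lemma inj_on_g: "inj_on (g A) (carrier A)"
proof (rule inj_onI)
  fix a b assume "a \<in> carrier A" "b \<in> carrier A" "g A a = g A b"
  then show "a = b"
    using g_subset_iff[of a b] g_subset_iff[of b a] le_antisym by simp
qed

lemma g_eq_empty_iff: "a \<in> carrier A \<Longrightarrow> g A a = {} \<longleftrightarrow> a = \<bottom>"
  using g_subset_iff[of a \<bottom>] g_bottom le_bottom[of a] bottom_closed by auto

section \<open>The topology of the clan space\<close>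

lemmas topspace_clan = topspace_clan_topology[OF boolean_lattice_axioms]

lemma closedin_g:
  assumes "a \<in> carrier A" shows "closedin (clan_topology A) (g A a)"
proof -
  have "openin (clan_topology A) (t_clans A - g A a)"
    unfolding openin_clan_topology[OF boolean_lattice_axioms]
    using assms by (blast intro: arbitrary_union_of_inc)
  then show ?thesis
    by (auto simp: closedin_def topspace_clan g_def)
qed

text \<open>A closed set is an intersection of basic sets \<open>g A a\<close>, so a point outside
  it is already outside one of them.\<close>

lemma closedin_separation:
  assumes F: "closedin (clan_topology A) F" and \<Gamma>: "\<Gamma> \<in> t_clans A" "\<Gamma> \<notin> F"
  obtains a where "a \<in> carrier A" "F \<subseteq> g A a" "a \<notin> \<Gamma>"
proof -
  have "(arbitrary union_of (\<lambda>U. \<exists>a\<in>carrier A. U = t_clans A - g A a)) (t_clans A - F)"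
    using F by (simp add: closedin_def topspace_clan openin_clan_topology[OF boolean_lattice_axioms])
  then obtain U where "\<exists>a\<in>carrier A. U = t_clans A - g A a" "\<Gamma> \<in> U" "U \<subseteq> t_clans A - F"
    unfolding arbitrary_union_of_alt using \<Gamma> by blast
  then obtain a where a: "a \<in> carrier A" "\<Gamma> \<in> t_clans A - g A a" "t_clans A - g A a \<subseteq> t_clans A - F"
    by blast
  then have "F \<subseteq> g A a" "a \<notin> \<Gamma>"
    using closedin_subset[OF F] \<Gamma> by (auto simp: topspace_clan g_def)
  then show thesis using that a by blast
qed

text \<open>One inclusion holds because \<open>g A a\<close> and \<open>g A (compl A a)\<close>
  cover the space. For the other, any basic set \<open>g A b\<close> containing the complement of
  \<open>g A a\<close> has \<open>a \<squnion> b = \<top>\<close>, hence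
  \<open>compl A a \<sqsubseteq> b\<close>, and so it contains
  \<open>g A (compl A a)\<close>.\<close>

lemma closure_of_Diff_g:
  assumes a: "a \<in> carrier A"
  shows "clan_topology A closure_of (t_clans A - g A a) = g A (compl A a)" (is "?K = _")
proof (rule antisym)
  have "t_clans A \<subseteq> g A a \<union> g A (compl A a)"
    using g_join[OF a compl_closed[OF a]] join_compl[OF a] g_top by simp
  then show "?K \<subseteq> g A (compl A a)"
    using closedin_g[OF compl_closed[OF a]] by (intro closure_of_minimal) auto
  show "g A (compl A a) \<subseteq> ?K"
  proof (rule ccontr)
    assume "\<not> ?thesis"
    then obtain \<Gamma> where \<Gamma>: "\<Gamma> \<in> t_clans A" "compl A a \<in> \<Gamma>" "\<Gamma> \<notin> ?K"
      by (auto simp: g_def)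
    obtain b where b: "b \<in> carrier A" "?K \<subseteq> g A b" "b \<notin> \<Gamma>"
      by (rule closedin_separation[OF closedin_closure_of \<Gamma>(1,3)])
    have "t_clans A - g A a \<subseteq> g A b"
      using closure_of_subset[of "t_clans A - g A a" "clan_topology A"] b
      by (auto simp: topspace_clan)
    then have "g A \<top> \<subseteq> g A (a \<squnion> b)"
      using a b g_join g_top by auto
    then have "\<top> \<sqsubseteq> a \<squnion> b"
      using a b g_subset_iff by simp
    then have "a \<squnion> b = \<top>"
      using a b by (meson join_closed le_antisym top_closed top_higher)
    then have "compl A a \<sqsubseteq> b"
      using a b compl_le_iff by simp
    then show False
      using \<Gamma> b unfolding t_clans_iff by blast
  qed
qed

section \<open>The map \<open>g\<close> as a dense Boolean embedding\<close>

abbreviation M :: "'a set set dyn_struct" where "M \<equiv> RC (canonical_space A)"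

lemma canonical_space_simps:
  "time_space (canonical_space A) = clan_topology A"
  "space_pts (canonical_space A) = s_clans A"
  "before (canonical_space A) = (\<lambda>\<Gamma> \<Delta>. \<forall>a\<in>\<Gamma>. \<forall>b\<in>\<Delta>. Bf A a b)"
  by (simp_all add: canonical_space_def)

text \<open>Reading \<open>closure_of_Diff_g\<close> at \<open>compl A a\<close> exhibits
  \<open>g A a\<close> as the closure of an open set.\<close>

lemma g_in_carrier:
  assumes "a \<in> carrier A" shows "g A a \<in> carrier M"
proof -
  have "openin (clan_topology A) (t_clans A - g A (compl A a))"
    using closedin_g[OF compl_closed[OF assms]] by (simp add: closedin_def topspace_clan)
  from regular_closed_closure_of[OF this] show ?thesis
    using closure_of_Diff_g[OF compl_closed[OF assms]] assms
    by (simp add: carrier_RC canonical_space_simps compl_compl)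
qed

lemma carrier_M_closedin: "c \<in> carrier M \<Longrightarrow> closedin (clan_topology A) c"
  by (simp add: carrier_RC canonical_space_simps regular_closed_imp_closedin)

lemma carrier_M_subset: "c \<in> carrier M \<Longrightarrow> c \<subseteq> t_clans A"
  using carrier_M_closedin closedin_subset topspace_clan by blast

lemma boolean_hom_g: "boolean_hom A M (g A)"
proof -
  interpret RC: boolean_lattice M by (rule boolean_lattice_RC)
  have join: "g A (a \<squnion> b) = g A a \<squnion>\<^bsub>M\<^esub> g A b" if "a \<in> carrier A" "b \<in> carrier A" for a b
    using that by (simp only: g_join join_RC g_in_carrier)
  have compl: "g A (compl A a) = compl M (g A a)" if "a \<in> carrier A" for a
    using that by (simp only: compl_RC g_in_carrier canonical_space_simps topspace_clan closure_of_Diff_g)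
  have meet: "g A (a \<sqinter> b) = g A a \<sqinter>\<^bsub>M\<^esub> g A b" if "a \<in> carrier A" "b \<in> carrier A" for a b
    using that
    by (simp only: meet_eq_compl_join_compl RC.meet_eq_compl_join_compl g_in_carrier compl join
        compl_closed join_closed)
  show ?thesis
    unfolding boolean_hom_def
    using join meet compl g_in_carrier g_bottom g_top
    by (simp add: bottom_RC top_RC canonical_space_simps topspace_clan)
qed

text \<open>A point in the interior of \<open>c\<close> is separated by some \<open>g A a\<close>
  from the complement of that interior. The complement of \<open>g A a\<close> then lies in the
  interior of \<open>c\<close>, and its closure \<open>g A (compl A a)\<close> lies in
  \<open>c\<close>.\<close>

lemma dense_in_g: "dense_in M (g A ` carrier A)"
  unfolding dense_in_def
proof (intro ballI impI)
  fix c assume c: "c \<in> carrier M" "c \<noteq> \<bottom>\<^bsub>M\<^esub>"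
  let ?X = "clan_topology A"
  have reg: "?X closure_of (?X interior_of c) = c"
    using c(1) by (simp add: carrier_RC canonical_space_simps regular_closed_def)
  have "?X interior_of c \<noteq> {}"
    using reg c(2) by (auto simp: bottom_RC)
  then obtain \<Gamma> where \<Gamma>: "\<Gamma> \<in> ?X interior_of c" by blast
  then have \<Gamma>t: "\<Gamma> \<in> t_clans A"
    using interior_of_subset_topspace[of ?X c] topspace_clan by blast
  have "closedin ?X (topspace ?X - ?X interior_of c)"
    by (simp add: closedin_diff)
  then obtain a where a: "a \<in> carrier A" "topspace ?X - ?X interior_of c \<subseteq> g A a" "a \<notin> \<Gamma>"
    using closedin_separation[OF _ \<Gamma>t] \<Gamma> by (metis Diff_iff)
  then have "t_clans A - g A a \<subseteq> ?X interior_of c"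
    using topspace_clan by blast
  then have "g A (compl A a) \<subseteq> c"
    using closure_of_mono[of _ _ ?X] closure_of_Diff_g[OF a(1)] reg by blast
  \<comment> \<open>Otherwise \<open>a\<close> would be \<open>\<top>\<close>, which belongs to
    \<open>\<Gamma>\<close>.\<close>
  moreover have "compl A a \<noteq> \<bottom>"
    using a(1,3) \<Gamma>t compl_compl[OF a(1)] compl_bottom unfolding t_clans_iff by auto
  then have "g A (compl A a) \<noteq> {}"
    using g_eq_empty_iff compl_closed[OF a(1)] by blast
  ultimately show "\<exists>a1\<in>g A ` carrier A. a1 \<noteq> \<bottom>\<^bsub>M\<^esub> \<and> a1 \<sqsubseteq>\<^bsub>M\<^esub> c"
    using compl_closed[OF a(1)] by (auto simp: bottom_RC)
qed

section \<open>Clans inside regular closed sets\<close>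

lemma s_clan_of_Cs:
  assumes "a \<in> carrier A" "b \<in> carrier A" "Cs A a b"
  obtains \<Gamma> where "\<Gamma> \<in> s_clans A" "a \<in> \<Gamma>" "b \<in> \<Gamma>"
proof -
  have "precontact A (Cs A)"
    using contact_Cs by (simp add: contact_def)
  \<comment> \<open>By monotonicity, contact of \<open>a\<close> and \<open>b\<close> spreads to
    their principal filters, which \<open>clan_extension\<close> then merges into one
    s-clan.\<close>
  then have Cs: "Cs A x y"
    if "x \<in> {x \<in> carrier A. a \<sqsubseteq> x}" "y \<in> {x \<in> carrier A. b \<sqsubseteq> x}" for x y
    using that assms precontact_mono[of "Cs A" a b x y] by simp
  obtain \<Gamma> where "clan A (Cs A) \<Gamma>"
      "{x \<in> carrier A. a \<sqsubseteq> x} \<subseteq> \<Gamma>" "{x \<in> carrier A. b \<sqsubseteq> x} \<subseteq> \<Gamma>"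
    by (rule clan_extension[OF contact_Cs filter_on_principal[OF assms(1)]
        filter_on_principal[OF assms(2)] Cs])
  moreover have "a \<sqsubseteq> a" "b \<sqsubseteq> b"
    using assms by auto
  ultimately show thesis
    using that[of \<Gamma>] assms unfolding s_clans_def by blast
qed

lemma nonempty_regular_closed:
  assumes "c \<in> carrier M" "c \<noteq> {}"
  obtains a where "a \<in> carrier A" "a \<noteq> \<bottom>" "g A a \<subseteq> c"
proof -
  have "\<exists>a1\<in>g A ` carrier A. a1 \<noteq> {} \<and> a1 \<subseteq> c"
    using dense_in_g assms unfolding dense_in_def bottom_RC RC_simps by blast
  then obtain a where "a \<in> carrier A" "g A a \<noteq> {}" "g A a \<subseteq> c"
    by blast
  then show thesis
    using that[of a] g_eq_empty_iff by blast
qed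

lemma s_clan_in_regular_closed:
  assumes "c \<in> carrier M" "c \<noteq> {}"
  shows "c \<inter> s_clans A \<noteq> {}"
proof -
  obtain a where a: "a \<in> carrier A" "a \<noteq> \<bottom>" "g A a \<subseteq> c"
    using nonempty_regular_closed assms .
  \<comment> \<open>A nonzero element overlaps itself and is therefore in space contact with
    itself.\<close>
  have "a \<sqinter> a = a"
    using a le_iff_join[of a a] by auto
  then have "Cs A a a"
    using a contact_Cs unfolding contact_def by auto
  then obtain \<Gamma> where "\<Gamma> \<in> s_clans A" "a \<in> \<Gamma>"
    using s_clan_of_Cs a by blast
  then show ?thesis
    using a(3) s_clans_subset_t_clans unfolding g_def by blast
qed

text \<open>The set of all nonzero elements lies in \<open>g A a\<close> for every nonzero
  \<open>a\<close>. It is one point common to all nonempty regular closed sets, which is what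
  \<open>Ct_M\<close> uses.\<close>

lemma largest_t_clan_in_regular_closed:
  assumes c: "c \<in> carrier M" "c \<noteq> {}"
  shows "carrier A - {\<bottom>} \<in> c"
proof -
  obtain a where a: "a \<in> carrier A" "a \<noteq> \<bottom>" "g A a \<subseteq> c"
    using nonempty_regular_closed c .
  \<comment> \<open>The nonzero \<open>a\<close> excludes the one-element algebra, which has no
    t-clans.\<close>
  have "\<top> \<noteq> \<bottom>"
    using a le_bottom top_higher by metis
  moreover have "\<bottom> \<squnion> \<bottom> = \<bottom>"
    using bottom_join_eq by simp
  ultimately have "carrier A - {\<bottom>} \<in> t_clans A"
    unfolding t_clans_iff using le_bottom by auto
  then show ?thesis
    using a unfolding g_def by blast
qed

section \<open>The three relations on regular closed sets\<close>

lemma Ct_M: "a \<in> carrier M \<Longrightarrow> b \<in> carrier M \<Longrightarrow> Ct M a b \<longleftrightarrow> a \<noteq> {} \<and> b \<noteq> {}"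
  using largest_t_clan_in_regular_closed by auto

lemma before_t_clans:
  assumes "\<Gamma> \<in> t_clans A" "\<Delta> \<in> t_clans A"
  shows "before (canonical_space A) \<Gamma> \<Delta>"
  unfolding canonical_space_simps
proof (intro ballI)
  fix a b assume "a \<in> \<Gamma>" "b \<in> \<Delta>"
  then show "Bf A a b"
    using assms Bf_iff[of a b] unfolding t_clans_iff by blast
qed

lemma Bf_M: "a \<in> carrier M \<Longrightarrow> b \<in> carrier M \<Longrightarrow> Bf M a b \<longleftrightarrow> a \<noteq> {} \<and> b \<noteq> {}"
  using before_t_clans carrier_M_subset[of a] carrier_M_subset[of b]
  unfolding RC_simps by blast

lemma Cs_M: "Cs M a b \<longleftrightarrow> a \<inter> b \<inter> s_clans A \<noteq> {}"
  by (simp add: canonical_space_simps)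

text \<open>For \<open>Ct\<close> and \<open>Bf\<close> both sides say that \<open>a\<close> and
  \<open>b\<close> are nonzero. For \<open>Cs\<close>, contact yields a common s-clan by
  \<open>s_clan_of_Cs\<close>, and conversely members of one s-clan are in contact by
  definition.\<close>

lemma g_relations:
  assumes "a \<in> carrier A" "b \<in> carrier A"
  shows Cs_g: "Cs A a b \<longleftrightarrow> Cs M (g A a) (g A b)"
    and Ct_g: "Ct A a b \<longleftrightarrow> Ct M (g A a) (g A b)"
    and Bf_g: "Bf A a b \<longleftrightarrow> Bf M (g A a) (g A b)"
proof -
  show "Ct A a b \<longleftrightarrow> Ct M (g A a) (g A b)" "Bf A a b \<longleftrightarrow> Bf M (g A a) (g A b)"
    using assms by (simp_all only: Ct_M Bf_M g_in_carrier Ct_iff Bf_iff g_eq_empty_iff)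
  show "Cs A a b \<longleftrightarrow> Cs M (g A a) (g A b)"
  proof
    assume "Cs A a b"
    then obtain \<Gamma> where "\<Gamma> \<in> s_clans A" "a \<in> \<Gamma>" "b \<in> \<Gamma>"
      using s_clan_of_Cs assms by blast
    then show "Cs M (g A a) (g A b)"
      using s_clans_subset_t_clans unfolding Cs_M g_def by blast
  next
    assume "Cs M (g A a) (g A b)"
    then show "Cs A a b"
      unfolding Cs_M g_def s_clans_def clan_def by blast
  qed
qed

section \<open>Separability of the image of \<open>g\<close>\<close>

lemma separable_in_trivial:
  assumes R: "\<And>a b. a \<in> carrier M \<Longrightarrow> b \<in> carrier M \<Longrightarrow> R a b \<longleftrightarrow> a \<noteq> {} \<and> b \<noteq> {}"
  shows "separable_in M R (g A ` carrier A)"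
  unfolding separable_in_def
proof (intro ballI impI)
  fix a b assume ab: "a \<in> carrier M" "b \<in> carrier M" "\<not> R a b"
  \<comment> \<open>These two sets, the images of \<open>\<bottom>\<close> and
    \<open>\<top>\<close>, enclose any unrelated pair, since one member of such a pair is
    empty.\<close>
  have top: "{} \<in> g A ` carrier A" "t_clans A \<in> g A ` carrier A"
    using g_bottom g_top bottom_closed top_closed by (metis imageI)+
  have car: "{} \<in> carrier M" "t_clans A \<in> carrier M"
    using g_in_carrier[OF bottom_closed] g_in_carrier[OF top_closed]
    by (simp_all only: g_bottom g_top)
  have "a = {} \<or> b = {}" using ab R by blast
  then have "\<exists>a1\<in>g A ` carrier A. \<exists>b1\<in>g A ` carrier A. \<not> R a1 b1 \<and> a \<subseteq> a1 \<and> b \<subseteq> b1"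
  proof
    assume "a = {}"
    then show ?thesis
      using R[OF car] top carrier_M_subset[OF ab(2)] by blast
  next
    assume "b = {}"
    then show ?thesis
      using R[OF car(2,1)] top carrier_M_subset[OF ab(1)] by blast
  qed
  then show "\<exists>a1\<in>g A ` carrier A. \<exists>b1\<in>g A ` carrier A. \<not> R a1 b1 \<and> a \<sqsubseteq>\<^bsub>M\<^esub> a1 \<and> b \<sqsubseteq>\<^bsub>M\<^esub> b1"
    by simp
qed

text \<open>Closure under meets needs \<open>c\<close> to be regular closed: \<open>g (x \<sqinter> y)\<close> is in general
  smaller than \<open>g x \<inter> g y\<close>.\<close>

lemma filter_on_g_above:
  assumes c: "c \<in> carrier M"
  shows "filter_on A {x \<in> carrier A. c \<subseteq> g A x}"
proof -
  interpret RC: boolean_lattice M by (rule boolean_lattice_RC)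
  have "c \<subseteq> g A (x \<sqinter> y)" if "x \<in> carrier A" "y \<in> carrier A" "c \<subseteq> g A x" "c \<subseteq> g A y" for x y
  proof -
    have "c \<subseteq> g A x \<sqinter>\<^bsub>M\<^esub> g A y"
      using RC.meet_le[of c "g A x" "g A y"] that c g_in_carrier by simp
    then show ?thesis
      using that boolean_hom_g unfolding boolean_hom_def by simp
  qed
  moreover have "c \<subseteq> g A y" if "c \<subseteq> g A x" "y \<in> carrier A" "x \<sqsubseteq> y" for x y
    using that g_mono by blast
  ultimately show ?thesis
    unfolding filter_on_def using g_top carrier_M_subset[OF c]
    by (intro conjI ballI impI CollectI) (simp_all, meson)
qed

lemma separable_in_Cs: "separable_in M (Cs M) (g A ` carrier A)"
  unfolding separable_in_def
proof (intro ballI impI)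
  fix a b assume ab: "a \<in> carrier M" "b \<in> carrier M" "\<not> Cs M a b"
  let ?F = "\<lambda>c. {x \<in> carrier A. c \<subseteq> g A x}"
  show "\<exists>a1\<in>g A ` carrier A. \<exists>b1\<in>g A ` carrier A. \<not> Cs M a1 b1 \<and> a \<sqsubseteq>\<^bsub>M\<^esub> a1 \<and> b \<sqsubseteq>\<^bsub>M\<^esub> b1"
  proof (rule ccontr)
    assume no: "\<not> ?thesis"
    \<comment> \<open>Failure of separation puts all \<open>g A x\<close> and \<open>g A y\<close>
      from the two filters in contact, and \<open>Cs_g\<close> carries this back to
      \<open>A\<close>.\<close>
    have Cs: "Cs A x y" if "x \<in> ?F a" "y \<in> ?F b" for x y
    proof -
      have "Cs M (g A x) (g A y)"
        using no that unfolding RC_simps(2) by blast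
      then show ?thesis using Cs_g that by blast
    qed
    obtain \<Gamma> where "clan A (Cs A) \<Gamma>" and sub: "?F a \<subseteq> \<Gamma>" "?F b \<subseteq> \<Gamma>"
      by (rule clan_extension[OF contact_Cs filter_on_g_above[OF ab(1)]
          filter_on_g_above[OF ab(2)] Cs])
    then have \<Gamma>: "\<Gamma> \<in> s_clans A" by (simp add: s_clans_def)
    then have t: "\<Gamma> \<in> t_clans A" using s_clans_subset_t_clans by blast
    \<comment> \<open>If the closed set \<open>c\<close> missed \<open>\<Gamma>\<close>, some
      \<open>x\<close> in \<open>?F c\<close> would lie outside \<open>\<Gamma>\<close>.\<close>
    have "\<Gamma> \<in> c" if "c \<in> carrier M" "?F c \<subseteq> \<Gamma>" for c
      using closedin_separation[OF carrier_M_closedin[OF that(1)] t] that(2) by blast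
    then show False
      using ab \<Gamma> sub unfolding Cs_M by blast
  qed
qed

section \<open>Stability of \<open>g\<close> and triviality of the regular closed algebra\<close>

theorem stable_embedding_g: "stable_embedding A M (g A)"
  unfolding stable_embedding_def
  using boolean_hom_g inj_on_g g_relations dense_in_g separable_in_Cs
    separable_in_trivial[of "Ct M", OF Ct_M] separable_in_trivial[of "Bf M", OF Bf_M]
  by simp

theorem trivial_dca_RC: "trivial_dca M"
proof -
  interpret RC: boolean_lattice M by (rule boolean_lattice_RC)
  let ?D = "\<lambda>a b. a \<noteq> \<bottom>\<^bsub>M\<^esub> \<and> b \<noteq> \<bottom>\<^bsub>M\<^esub>"
  \<comment> \<open>The lattice meet itself serves as \<open>c\<close>. It turns the overlap axiom
    into a search for a point in a nonempty regular closed set.\<close>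
  have meet_nonempty: "\<exists>c \<in> carrier M. c \<noteq> {} \<and> c \<subseteq> a \<inter> b"
    if "a \<in> carrier M" "b \<in> carrier M" "a \<sqinter>\<^bsub>M\<^esub> b \<noteq> \<bottom>\<^bsub>M\<^esub>" for a b
    using that RC.meet_left[of a b] RC.meet_right[of a b] RC.meet_closed[of a b]
    unfolding bottom_RC RC_simps by blast
  have preCs: "precontact M (Cs M)"
    unfolding precontact_def Cs_M bottom_RC RC_simps(2)
    by (intro conjI ballI impI) (auto simp: join_RC)
  have Cs: "contact M (Cs M)"
    unfolding contact_def
  proof (intro conjI ballI impI preCs)
    fix a b assume "a \<in> carrier M" "b \<in> carrier M" "a \<sqinter>\<^bsub>M\<^esub> b \<noteq> \<bottom>\<^bsub>M\<^esub>"
    then obtain c where "c \<in> carrier M" "c \<noteq> {}" "c \<subseteq> a \<inter> b"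
      using meet_nonempty by blast
    then show "Cs M a b"
      using s_clan_in_regular_closed[of c] unfolding Cs_M by blast
  qed (auto simp: Cs_M)
  have preCt: "precontact M (Ct M)"
    unfolding precontact_def bottom_RC RC_simps
    by (intro conjI ballI impI) (auto simp: join_RC)
  have Ct: "contact M (Ct M)"
    unfolding contact_def
  proof (intro conjI ballI impI preCt)
    fix a b assume "a \<in> carrier M" "b \<in> carrier M" "a \<sqinter>\<^bsub>M\<^esub> b \<noteq> \<bottom>\<^bsub>M\<^esub>"
    then show "Ct M a b"
      using meet_nonempty[of a b] by auto
  qed auto
  have Bf: "precontact M (Bf M)"
    unfolding precontact_def bottom_RC RC_simps
    by (intro conjI ballI impI) (auto simp: join_RC)
  \<comment> \<open>The three relation parameters let the Efremovich axiom and both interpolation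
    axioms for \<open>Bf\<close> be instances of one statement, with \<open>\<top>\<close> or
    \<open>\<bottom>\<close> as interpolant.\<close>
  have itp: "\<forall>a\<in>carrier M. \<forall>b\<in>carrier M. \<not> R'' a b \<longrightarrow>
        (\<exists>c\<in>carrier M. \<not> R a c \<and> \<not> R' (compl M c) b)"
    if R: "\<And>a b. a \<in> carrier M \<Longrightarrow> b \<in> carrier M \<Longrightarrow> R a b \<longleftrightarrow> a \<noteq> {} \<and> b \<noteq> {}"
      "\<And>a b. a \<in> carrier M \<Longrightarrow> b \<in> carrier M \<Longrightarrow> R' a b \<longleftrightarrow> a \<noteq> {} \<and> b \<noteq> {}"
      "\<And>a b. a \<in> carrier M \<Longrightarrow> b \<in> carrier M \<Longrightarrow> R'' a b \<longleftrightarrow> a \<noteq> {} \<and> b \<noteq> {}"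
    for R R' R''
  proof (intro ballI impI)
    fix a b assume ab: "a \<in> carrier M" "b \<in> carrier M" "\<not> R'' a b"
    then have "a = {} \<or> b = {}" using R(3) by blast
    then show "\<exists>c\<in>carrier M. \<not> R a c \<and> \<not> R' (compl M c) b"
    proof
      assume "a = {}"
      then have "\<not> R a \<top>\<^bsub>M\<^esub> \<and> \<not> R' (compl M \<top>\<^bsub>M\<^esub>) b"
        using R ab RC.top_closed RC.compl_top RC.bottom_closed bottom_RC by metis
      then show ?thesis using RC.top_closed by blast
    next
      assume "b = {}"
      then have "\<not> R a \<bottom>\<^bsub>M\<^esub> \<and> \<not> R' (compl M \<bottom>\<^bsub>M\<^esub>) b"
        using R ab RC.top_closed RC.compl_bottom RC.bottom_closed bottom_RC by metis
      then show ?thesis using RC.bottom_closed by blast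
    qed
  qed
  have le: "\<forall>a\<in>carrier M. \<forall>b\<in>carrier M. Cs M a b \<longrightarrow> Ct M a b"
    by auto
  have all: "\<forall>a\<in>carrier M. \<forall>b\<in>carrier M. ?D a b \<longrightarrow> Ct M a b \<and> Bf M a b"
    unfolding bottom_RC using Ct_M Bf_M by blast
  show ?thesis
    unfolding trivial_dca_def dca_def
    by (intro conjI RC.boolean_lattice_axioms Cs Ct Bf le all itp[of "Ct M" "Ct M" "Ct M"]
        itp[of "Ct M" "Bf M" "Bf M"] itp[of "Bf M" "Ct M" "Bf M"]) (simp_all only: Ct_M Bf_M)
qed

end

theorem theorem5p30:
  fixes L :: "'a gorder" and C :: "'a \<Rightarrow> 'a \<Rightarrow> bool"
  assumes "contact_algebra L C"
  shows "trivial_dca (RC (canonical_space (trivial_dca_of L C))) \<and>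
    stable_embedding (trivial_dca_of L C) (RC (canonical_space (trivial_dca_of L C)))
      (g (trivial_dca_of L C))"
proof -
  interpret trivial_dynamic_contact "trivial_dca_of L C"
    using trivial_dca_trivial_dca_of[OF assms] by unfold_locales
  show ?thesis
    using trivial_dca_RC stable_embedding_g by blast
qed

end
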